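(* Fix a prescribed drawdown limit $d_{\max}\in[0,1)$ and a stage $k\in\{0,\dots,N-1\}$. Suppose that $(V(k),V_{\max}(k))\in\mathcal{S}_{d_{\max}}$. For a given control action $u(k)\in\mathbb{R}^m$, the successor state $(V(k+1),V_{\max}(k+1))$ (determined by $u(k)$ and the stage-$k$ return $x$) remains in $\mathcal{S}_{d_{\max}}$ for every $x\in\mathcal{X}_k$ if and only if $$\sigma_{\mathcal{X}_k}\bigl(-u(k)\bigr)+\varepsilon^\top|u(k)|\le M(k)V(k).\qquad(\ast)$$ Consequently, a causal policy $\pi$ is robustly drawdown-safe if and only if $(\ast)$, with $u(k)$ the control prescribed by $\pi$, holds at every stage $k=0,\dots,N-1$ and every state in $\mathcal{S}_{d_{\max}}$.
   Context: Fix a horizon $N\ge 1$, $m\ge 1$, an initial value $V_0>0$, a cost vector $\varepsilon\in\mathbb{R}_+^m$ (componentwise nonnegative), and nonempty compact sets $\mathcal{X}_k\subset\mathbb{R}^m$, $k=0,\dots,N-1$. For $u\in\mathbb{R}^m$, $|u|$ is the vector of componentwise absolute values. For a nonempty compact set $\mathcal{X}$, $\sigma_{\mathcal{X}}(z):=\sup_{x\in\mathcal{X}}z^\top x$. Dynamics: from a state $(V(k),V_{\max}(k))$, under control $u(k)$ and return $x$, the successor state is $V(k+1)=V(k)+u(k)^\top x-\varepsilon^\top|u(k)|$, $V_{\max}(k+1)=\max\{V_{\max}(k),V(k+1)\}$. The account starts at $V(0)=V_{\max}(0)=V_0$, so that $V_{\max}(k)=\max_{0\le i\le k}V(i)$.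 Percentage drawdown: $d(k):=\bigl(V_{\max}(k)-V(k)\bigr)/V_{\max}(k)$. Drawdown-safe set: $\mathcal{S}_{d_{\max}}:=\{(v,w)\in\mathbb{R}_+^2: w>0,\ (1-d_{\max})w\le v\le w\}$, where $\mathbb{R}_+=[0,\infty)$. Drawdown modulator (for a state in $\mathcal{S}_{d_{\max}}$): $M(k):=\dfrac{d_{\max}-d(k)}{1-d(k)}$. A causal policy is a sequence $\pi=\{\pi_k\}_{k=0}^{N-1}$ of measurable decision rules $\pi_k:\mathcal{X}_0\times\cdots\times\mathcal{X}_{k-1}\to\mathbb{R}^m$ ($\pi_0$ is a constant vector), generating the controls $u(0)=\pi_0$ and $u(k)=\pi_k(X(0),\dots,X(k-1))$, where $X(j)$ is the stage-$j$ return. A causal policy $\pi$ is robustly drawdown-safe if, for every stage $k=0,\dots,N-1$ and every current state $(V(k),V_{\max}(k))\in\mathcal{S}_{d_{\max}}$, the control prescribed by $\pi$ yields $(V(k+1),V_{\max}(k+1))\in\mathcal{S}_{d_{\max}}$ for every $x\in\mathcal{X}_k$. In this case $\mathcal{S}_{d_{\max}}$ is said to be robustly invariant under $\pi$. *)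

theory Defs
  imports "HOL-Analysis.Analysis"
begin

text \<open>A state of the account is a pair \<open>(v, w)\<close> of the account value \<open>v = V(k)\<close> and its running
  maximum \<open>w = V\<^sub>m\<^sub>a\<^sub>x(k)\<close>. On \<^typ>\<open>real ^ 'm\<close>, both \<open>\<le>\<close> and \<open>\<bar>_\<bar>\<close> are componentwise.\<close>

definition support_function :: "(real ^ 'm) set \<Rightarrow> real ^ 'm \<Rightarrow> real" where
  "support_function X z = (SUP x\<in>X. z \<bullet> x)"

definition successor ::
  "real ^ 'm \<Rightarrow> real ^ 'm \<Rightarrow> real ^ 'm \<Rightarrow> real \<times> real \<Rightarrow> real \<times> real" where
  "successor \<epsilon> u x = (\<lambda>(v, w).
     let v' = v + u \<bullet> x - \<epsilon> \<bullet> \<bar>u\<bar> in (v', max w v'))"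

definition drawdown :: "real \<Rightarrow> real \<Rightarrow> real" where
  "drawdown v w = (w - v) / w"

definition safe_set :: "real \<Rightarrow> (real \<times> real) set" where
  "safe_set dmax = {(v, w). 0 \<le> v \<and> 0 \<le> w \<and> w > 0 \<and> (1 - dmax) * w \<le> v \<and> v \<le> w}"

definition modulator :: "real \<Rightarrow> real \<Rightarrow> real \<Rightarrow> real" where
  "modulator dmax v w = (dmax - drawdown v w) / (1 - drawdown v w)"

text \<open>The return history \<open>(x\<^sub>0, \<dots>, x\<^sub>k\<^sub>-\<^sub>1)\<close> available at stage \<open>k\<close> is an element of
  \<open>\<Pi>\<^sub>E j\<in>{..<k}. X j\<close>; for \<open>k = 0\<close> this is a singleton, so that \<open>\<pi> 0\<close> amounts to a constant
  vector. Decision rules only matter on these histories, which form the space of the product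
  \<open>\<sigma>\<close>-algebra used below.\<close>

definition causal_policy ::
  "nat \<Rightarrow> (nat \<Rightarrow> (real ^ 'm) set) \<Rightarrow> (nat \<Rightarrow> (nat \<Rightarrow> real ^ 'm) \<Rightarrow> real ^ 'm) \<Rightarrow> bool" where
  "causal_policy N X \<pi> \<longleftrightarrow>
     (\<forall>k<N. \<pi> k \<in> borel_measurable (\<Pi>\<^sub>M j\<in>{..<k}. restrict_space borel (X j)))"

text \<open>The state after \<open>k\<close> stages under policy \<open>\<pi>\<close> and returns \<open>x 0, \<dots>, x (k - 1)\<close>, with
  \<open>V(0) = V\<^sub>m\<^sub>a\<^sub>x(0) = V0\<close>. The restriction hands \<open>\<pi> k\<close> only the returns before stage \<open>k\<close>.\<close>

primrec account_state ::
  "real \<Rightarrow> real ^ 'm \<Rightarrow> (nat \<Rightarrow> (nat \<Rightarrow> real ^ 'm) \<Rightarrow> real ^ 'm) \<Rightarrow> (nat \<Rightarrow> real ^ 'm) \<Rightarrow> nat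
    \<Rightarrow> real \<times> real" where
  "account_state V0 \<epsilon> \<pi> x 0 = (V0, V0)"
| "account_state V0 \<epsilon> \<pi> x (Suc k) =
     successor \<epsilon> (\<pi> k (restrict x {..<k})) (x k) (account_state V0 \<epsilon> \<pi> x k)"

lemma account_state_running_max:
  "snd (account_state V0 \<epsilon> \<pi> x k) = (MAX i\<in>{..k}. fst (account_state V0 \<epsilon> \<pi> x i))"
proof (induction k)
  case 0
  show ?case by simp
next
  case (Suc k)
  have "snd (account_state V0 \<epsilon> \<pi> x (Suc k))
      = max (fst (account_state V0 \<epsilon> \<pi> x (Suc k))) (snd (account_state V0 \<epsilon> \<pi> x k))"
    by (simp add: successor_def Let_def case_prod_beta max.commute)
  also have "\<dots> = (MAX i\<in>{..Suc k}. fst (account_state V0 \<epsilon> \<pi> x i))"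
    unfolding Suc.IH atMost_Suc image_insert
    by (subst Max_insert) auto
  finally show ?case .
qed

text \<open>A causal policy acts on return histories, and the current state at stage \<open>k\<close> is the one which
  the history and the policy produce from \<open>(V0, V0)\<close>.\<close>

definition robustly_drawdown_safe ::
  "nat \<Rightarrow> (nat \<Rightarrow> (real ^ 'm) set) \<Rightarrow> real \<Rightarrow> real ^ 'm \<Rightarrow> real
    \<Rightarrow> (nat \<Rightarrow> (nat \<Rightarrow> real ^ 'm) \<Rightarrow> real ^ 'm) \<Rightarrow> bool" where
  "robustly_drawdown_safe N X V0 \<epsilon> dmax \<pi> \<longleftrightarrow>
     (\<forall>k<N. \<forall>h\<in>(\<Pi>\<^sub>E j\<in>{..<k}. X j).
        account_state V0 \<epsilon> \<pi> h k \<in> safe_set dmax \<longrightarrow>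
        (\<forall>x\<in>X k. successor \<epsilon> (\<pi> k h) x (account_state V0 \<epsilon> \<pi> h k) \<in> safe_set dmax))"

text \<open>The variant in which the current state ranges over the whole safe set, independently of
  the history; safety in this sense implies the one above.\<close>

definition robustly_drawdown_safe_all_states ::
  "nat \<Rightarrow> (nat \<Rightarrow> (real ^ 'm) set) \<Rightarrow> real ^ 'm \<Rightarrow> real
    \<Rightarrow> (nat \<Rightarrow> (nat \<Rightarrow> real ^ 'm) \<Rightarrow> real ^ 'm) \<Rightarrow> bool" where
  "robustly_drawdown_safe_all_states N X \<epsilon> dmax \<pi> \<longleftrightarrow>
     (\<forall>k<N. \<forall>h\<in>(\<Pi>\<^sub>E j\<in>{..<k}. X j). \<forall>s\<in>safe_set dmax.
        \<forall>x\<in>X k. successor \<epsilon> (\<pi> k h) x s \<in> safe_set dmax)"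

end

theory Submission
  imports Defs
begin

text \<open>In a safe state the modulator satisfies \<open>M V = V - (1 - d\<^sub>m\<^sub>a\<^sub>x) V\<^sub>m\<^sub>a\<^sub>x\<close>. A new maximum is
  always safe, so the successor is safe exactly if \<open>V(k+1)\<close> stays above the old floor
  \<open>(1 - d\<^sub>m\<^sub>a\<^sub>x) V\<^sub>m\<^sub>a\<^sub>x(k)\<close>, i.e. if loss plus cost is at most \<open>M V\<close>. Taking the supremum of the
  loss \<open>- u \<bullet> x\<close> over the returns gives the support function.\<close>

text \<open>Compactness bounds the continuous image of \<open>X\<close>, so the real supremum is a
  genuine least upper bound.\<close>

lemma support_function_le_iff:
  assumes "compact X" and "X \<noteq> {}"
  shows "support_function X z \<le> c \<longleftrightarrow> (\<forall>x\<in>X. z \<bullet> x \<le> c)"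
proof -
  have "compact ((\<lambda>x. z \<bullet> x) ` X)"
    by (intro compact_continuous_image continuous_intros assms)
  then have "bdd_above ((\<lambda>x. z \<bullet> x) ` X)"
    by (intro bounded_imp_bdd_above compact_imp_bounded)
  with \<open>X \<noteq> {}\<close> show ?thesis
    unfolding support_function_def by (rule cSUP_le_iff)
qed

text \<open>Numerator and denominator of the modulator share the denominator \<open>w\<close>, so it
  equals \<open>(v - (1 - dmax) * w) / v\<close>.\<close>

lemma modulator_times_value:
  assumes "(v, w) \<in> safe_set dmax" and "dmax < 1"
  shows "modulator dmax v w * v = v - (1 - dmax) * w"
proof -
  have w: "w > 0" and "(1 - dmax) * w \<le> v"
    using assms by (auto simp: safe_set_def)
  \<comment> \<open>The floor is strictly positive because \<open>dmax < 1\<close>; hence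
    \<open>v\<close> is nonzero and can be cancelled below.\<close>
  moreover have "(1 - dmax) * w > 0"
    using w assms(2) by simp
  ultimately have v: "v > 0"
    by linarith
  have "1 - drawdown v w = v / w"
    using w by (simp add: drawdown_def field_simps)
  moreover have "dmax - drawdown v w = (v - (1 - dmax) * w) / w"
    using w by (simp add: drawdown_def field_simps)
  ultimately show ?thesis
    using v w by (simp add: modulator_def)
qed

lemma successor_safe_iff:
  assumes "(v, w) \<in> safe_set dmax" and "0 \<le> dmax" and "dmax < 1"
  shows "successor \<epsilon> u x (v, w) \<in> safe_set dmax \<longleftrightarrow>
    (- u) \<bullet> x + \<epsilon> \<bullet> \<bar>u\<bar> \<le> modulator dmax v w * v"
proof -
  define v' where "v' = v + u \<bullet> x - \<epsilon> \<bullet> \<bar>u\<bar>"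
  have w: "w > 0"
    using assms(1) by (simp add: safe_set_def)
  \<comment> \<open>The remaining conditions hold automatically: the new maximum is at least
    \<open>w > 0\<close> and at least \<open>v'\<close>.\<close>
  have "successor \<epsilon> u x (v, w) \<in> safe_set dmax \<longleftrightarrow> 0 \<le> v' \<and> (1 - dmax) * max w v' \<le> v'"
    using w by (auto simp: successor_def safe_set_def Let_def v'_def[symmetric])
  also have "\<dots> \<longleftrightarrow> (1 - dmax) * w \<le> v'"
  proof
    assume "0 \<le> v' \<and> (1 - dmax) * max w v' \<le> v'"
    moreover have "(1 - dmax) * w \<le> (1 - dmax) * max w v'"
      using assms(3) by (intro mult_left_mono) auto
    ultimately show "(1 - dmax) * w \<le> v'"
      by linarith
  next
    assume floor: "(1 - dmax) * w \<le> v'"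
    moreover have "0 \<le> (1 - dmax) * w"
      using w assms(3) by simp
    ultimately have "0 \<le> v'"
      by linarith
    \<comment> \<open>This covers the case where \<open>v'\<close> is the new maximum; where
      \<open>w\<close> stays the maximum, \<open>floor\<close> is the claim.\<close>
    moreover from this have "(1 - dmax) * v' \<le> v'"
      using assms(2) by (simp add: algebra_simps)
    ultimately show "0 \<le> v' \<and> (1 - dmax) * max w v' \<le> v'"
      using floor by (simp add: max_def)
  qed
  also have "\<dots> \<longleftrightarrow> (- u) \<bullet> x + \<epsilon> \<bullet> \<bar>u\<bar> \<le> v - (1 - dmax) * w"
    by (auto simp: v'_def)
  finally show ?thesis
    by (simp only: modulator_times_value[OF assms(1,3)])
qed

text \<open>The cost does not depend on the return, so it moves to the right-hand side and leaves a
  uniform bound on \<open>(- u) \<bullet> x\<close>.\<close>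

lemma robust_successor_safe_iff:
  assumes "compact X" and "X \<noteq> {}" and "(v, w) \<in> safe_set dmax" and "0 \<le> dmax" and "dmax < 1"
  shows "(\<forall>x\<in>X. successor \<epsilon> u x (v, w) \<in> safe_set dmax) \<longleftrightarrow>
    support_function X (- u) + \<epsilon> \<bullet> \<bar>u\<bar> \<le> modulator dmax v w * v"
  using support_function_le_iff[OF assms(1,2), of "- u" "modulator dmax v w * v - \<epsilon> \<bullet> \<bar>u\<bar>"]
  by (simp only: successor_safe_iff[OF assms(3-5)] le_diff_eq)

theorem theorem3p2:
  fixes N :: nat and V0 dmax :: real and \<epsilon> :: "real ^ 'm" and X :: "nat \<Rightarrow> (real ^ 'm) set"
  assumes "N \<ge> 1" and "V0 > 0" and "0 \<le> \<epsilon>"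
    and "\<And>k. k < N \<Longrightarrow> compact (X k)" and "\<And>k. k < N \<Longrightarrow> X k \<noteq> {}"
    and "0 \<le> dmax" and "dmax < 1"
  shows
    "(\<forall>k<N. \<forall>v w. (v, w) \<in> safe_set dmax \<longrightarrow> (\<forall>u :: real ^ 'm.
        (\<forall>x\<in>X k. successor \<epsilon> u x (v, w) \<in> safe_set dmax) \<longleftrightarrow>
        support_function (X k) (- u) + \<epsilon> \<bullet> \<bar>u\<bar> \<le> modulator dmax v w * v)) \<and>
     (\<forall>\<pi>. causal_policy N X \<pi> \<longrightarrow>
        (robustly_drawdown_safe N X V0 \<epsilon> dmax \<pi> \<longleftrightarrow>
          (\<forall>k<N. \<forall>h\<in>(\<Pi>\<^sub>E j\<in>{..<k}. X j). \<forall>v w.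
             account_state V0 \<epsilon> \<pi> h k = (v, w) \<and> (v, w) \<in> safe_set dmax \<longrightarrow>
             support_function (X k) (- \<pi> k h) + \<epsilon> \<bullet> \<bar>\<pi> k h\<bar> \<le> modulator dmax v w * v)) \<and>
        (robustly_drawdown_safe_all_states N X \<epsilon> dmax \<pi> \<longleftrightarrow>
          (\<forall>k<N. \<forall>h\<in>(\<Pi>\<^sub>E j\<in>{..<k}. X j). \<forall>v w.
             (v, w) \<in> safe_set dmax \<longrightarrow>
             support_function (X k) (- \<pi> k h) + \<epsilon> \<bullet> \<bar>\<pi> k h\<bar> \<le> modulator dmax v w * v)))"
proof -
  have step: "(\<forall>x\<in>X k. successor \<epsilon> u x (v, w) \<in> safe_set dmax) \<longleftrightarrow>
      support_function (X k) (- u) + \<epsilon> \<bullet> \<bar>u\<bar> \<le> modulator dmax v w * v"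
    if "k < N" and "(v, w) \<in> safe_set dmax" for k v w u
    using that assms by (intro robust_successor_safe_iff)
  have "robustly_drawdown_safe N X V0 \<epsilon> dmax \<pi> \<longleftrightarrow>
      (\<forall>k<N. \<forall>h\<in>(\<Pi>\<^sub>E j\<in>{..<k}. X j). \<forall>v w.
         account_state V0 \<epsilon> \<pi> h k = (v, w) \<and> (v, w) \<in> safe_set dmax \<longrightarrow>
         support_function (X k) (- \<pi> k h) + \<epsilon> \<bullet> \<bar>\<pi> k h\<bar> \<le> modulator dmax v w * v)" for \<pi>
  proof -
    \<comment> \<open>A fixed stage and history determine one state and one control
      \<open>\<pi> k h\<close>, so \<open>step\<close> applies pointwise; splitting the state into a
      pair collapses the quantifiers over \<open>v\<close> and \<open>w\<close>.\<close>
    have "(account_state V0 \<epsilon> \<pi> h k \<in> safe_set dmax \<longrightarrow>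
          (\<forall>x\<in>X k. successor \<epsilon> (\<pi> k h) x (account_state V0 \<epsilon> \<pi> h k) \<in> safe_set dmax)) \<longleftrightarrow>
        (\<forall>v w. account_state V0 \<epsilon> \<pi> h k = (v, w) \<and> (v, w) \<in> safe_set dmax \<longrightarrow>
          support_function (X k) (- \<pi> k h) + \<epsilon> \<bullet> \<bar>\<pi> k h\<bar> \<le> modulator dmax v w * v)"
      if "k < N" for k h
      using step[OF that] by (cases "account_state V0 \<epsilon> \<pi> h k") auto
    then show ?thesis
      by (simp add: robustly_drawdown_safe_def)
  qed
  moreover have "robustly_drawdown_safe_all_states N X \<epsilon> dmax \<pi> \<longleftrightarrow>
      (\<forall>k<N. \<forall>h\<in>(\<Pi>\<^sub>E j\<in>{..<k}. X j). \<forall>v w.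
         (v, w) \<in> safe_set dmax \<longrightarrow>
         support_function (X k) (- \<pi> k h) + \<epsilon> \<bullet> \<bar>\<pi> k h\<bar> \<le> modulator dmax v w * v)" for \<pi>
    \<comment> \<open>Unfolding this one bounded quantifier turns safety of the state into a
      premise; \<open>imp_cong\<close> then lets it and \<open>k < N\<close> discharge the
      conditions of \<open>step\<close>.\<close>
    by (simp add: robustly_drawdown_safe_all_states_def Ball_def[of "safe_set dmax"] step
        cong: imp_cong)
  ultimately show ?thesis
    by (simp add: step)
qed

end
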